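(* Let $P$ be the one-step transition matrix on $S=\{0\}\cup\mathbb{N}\cup\{\infty\}$ of the Markov chain embedded in the success epochs of independent Bernoulli trials with success probabilities $p_j>0$, $j\ge1$. For each $n\in\mathbb{N}$, the $n$-step transition matrix $P^n$ preserves quasi-unimodality: if $f:S\to\mathbb{R}$ is bounded and quasi-unimodal, then $P^nf$, given by $(P^nf)_i=\sum_{j\in S}P^n(i,j)f_j$ for $i\in S$, is quasi-unimodal.
   Context: $S=\{0,1,2,\dots,\infty\}$ with its natural order ($\infty$ largest). With $q_j=1-p_j$, the transition matrix is $P(i,j)=0$ for $j\le i$, $j<\infty$; $P(i,j)=p_j\prod_{k=i+1}^{j-1}q_k$ for $i<j<\infty$; $P(i,\infty)=\prod_{k\ge i+1}q_k$ for $i<\infty$; $P(\infty,\infty)=1$ (empty products equal $1$). The number of sign changes of a real function on a totally ordered set is the supremum, over finite increasing tuples of points at which the function is nonzero, of the number of consecutive pairs with opposite signs. A real function $u$ on a totally ordered index set is quasi-unimodal if for every $\lambda\in\mathbb{R}$ the function $u-\lambda$ has at most two sign changes and, whenever exactly two occur, the sign pattern is $-,+,-$. *)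

theory Defs
  imports "HOL-Analysis.Analysis" "HOL-Library.Extended_Nat"
begin

definition nonzero_tuples :: "('a::linorder \<Rightarrow> real) \<Rightarrow> 'a list set" where
  "nonzero_tuples u = {xs. sorted_wrt (<) xs \<and> (\<forall>x\<in>set xs. u x \<noteq> 0)}"

definition tuple_sign_changes :: "('a \<Rightarrow> real) \<Rightarrow> 'a list \<Rightarrow> nat" where
  "tuple_sign_changes u xs = card {k. Suc k < length xs \<and> u (xs ! k) * u (xs ! Suc k) < 0}"

definition sign_changes :: "('a::linorder \<Rightarrow> real) \<Rightarrow> enat" where
  "sign_changes u = (SUP xs\<in>nonzero_tuples u. enat (tuple_sign_changes u xs))"

(* The signs along the tuple, with consecutive repetitions collapsed. *)
definition tuple_sign_pattern :: "('a \<Rightarrow> real) \<Rightarrow> 'a list \<Rightarrow> real list" where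
  "tuple_sign_pattern u xs = remdups_adj (map (\<lambda>x. sgn (u x)) xs)"

(* A finite supremum of naturals is attained, so if sign_changes u = 2 then some tuple has
   exactly two sign changes; the universally quantified clause below is not vacuous. *)
definition quasi_unimodal :: "('a::linorder \<Rightarrow> real) \<Rightarrow> bool" where
  "quasi_unimodal u \<longleftrightarrow>
     (\<forall>c::real. let v = (\<lambda>x. u x - c) in
        sign_changes v \<le> 2 \<and>
        (sign_changes v = 2 \<longrightarrow>
           (\<forall>xs\<in>nonzero_tuples v.
              tuple_sign_changes v xs = 2 \<longrightarrow> tuple_sign_pattern v xs = [-1, 1, -1])))"

(* The state space is the type enat. The infinite product is the limit of its partial products;
   prodinf would not do, since it is unspecified when nonzero factors have partial products
   tending to 0. The value p 0 is not used. *)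
definition success_kernel :: "(nat \<Rightarrow> real) \<Rightarrow> enat \<Rightarrow> enat \<Rightarrow> real" where
  "success_kernel p i j =
     (case i of
        enat a \<Rightarrow>
          (case j of
             enat b \<Rightarrow> if a < b then p b * (\<Prod>k\<in>{a<..<b}. 1 - p k) else 0
           | \<infinity> \<Rightarrow> lim (\<lambda>n. \<Prod>k\<in>{a<..n}. 1 - p k))
      | \<infinity> \<Rightarrow> (case j of enat b \<Rightarrow> 0 | \<infinity> \<Rightarrow> 1))"

primrec kernel_power :: "('s \<Rightarrow> 's \<Rightarrow> real) \<Rightarrow> nat \<Rightarrow> 's \<Rightarrow> 's \<Rightarrow> real" where
  "kernel_power K 0 = (\<lambda>i j. if i = j then 1 else 0)"
| "kernel_power K (Suc n) = (\<lambda>i j. \<Sum>\<^sub>\<infinity>k\<in>UNIV. K i k * kernel_power K n k j)"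

definition kernel_apply :: "('s \<Rightarrow> 's \<Rightarrow> real) \<Rightarrow> ('s \<Rightarrow> real) \<Rightarrow> 's \<Rightarrow> real" where
  "kernel_apply K f i = (\<Sum>\<^sub>\<infinity>j\<in>UNIV. K i j * f j)"

end

theory Submission imports Defs begin

text \<open>
  A function is quasi-unimodal iff it never takes at an intermediate point a value below its values
  on both sides. Let \<open>g = P f\<close> and suppose \<open>g i > c\<close>, \<open>g j < c\<close>, \<open>g k > c\<close> for some \<open>i < j < k\<close>.
  The backward recursion \<open>g (m - 1) = p\<^sub>m f m + (1 - p\<^sub>m) g m\<close> yields a point of \<open>(i, j]\<close> where
  \<open>f\<close> exceeds \<open>c\<close> and one of \<open>(j, k]\<close> where \<open>f\<close> is below \<open>c\<close>; since \<open>g k\<close> averages \<open>f\<close> over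
  points beyond \<open>k\<close> (or \<open>k = \<infinity>\<close> and \<open>g k = f k\<close>), \<open>f\<close> exceeds \<open>c\<close> again further on. The powers
  of \<open>P\<close> follow by iteration.
\<close>

subsection \<open>Quasi-unimodality\<close>

text \<open>Keeping the last point of each run of equal \<open>h\<close>-values suffices. It turns
  the collapsed sign pattern of a tuple into the uncollapsed signs of an increasing subtuple, so
  that its entries belong to actual points.\<close>

lemma remdups_adj_map_sorted_wrt:
  assumes "sorted_wrt R xs"
  obtains ys where "sorted_wrt R ys" "set ys \<subseteq> set xs" "map h ys = remdups_adj (map h xs)"
proof -
  have "\<exists>ys. sorted_wrt R ys \<and> set ys \<subseteq> set xs \<and> map h ys = remdups_adj (map h xs)"
    using assms
  proof (induction xs)
    case Nil
    then show ?case by auto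
  next
    case (Cons x xs)
    then obtain ys where ys: "sorted_wrt R ys" "set ys \<subseteq> set xs"
        "map h ys = remdups_adj (map h xs)"
      by auto
    show ?case
    proof (cases "xs \<noteq> [] \<and> h x = hd (map h xs)")
      case True
      then have "remdups_adj (map h (x # xs)) = remdups_adj (map h xs)"
        by (cases xs) auto
      with ys show ?thesis by auto
    next
      case False
      then have "remdups_adj (map h (x # xs)) = h x # remdups_adj (map h xs)"
        by (cases xs) auto
      moreover have "sorted_wrt R (x # ys)"
        using ys Cons.prems by auto
      ultimately show ?thesis
        using ys by (intro exI[of _ "x # ys"]) auto
    qed
  qed
  then show thesis using that by blast
qed

text \<open>Between nonzero values a negative product is the same as a change of \<open>sgn\<close>,
  so every sign change opens a new run. A zero value would add a run without a negative
  product.\<close>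

lemma tuple_sign_changes_eq_length_pattern:
  assumes "\<forall>x\<in>set xs. u x \<noteq> 0"
  shows "tuple_sign_changes u xs = length (tuple_sign_pattern u xs) - 1"
  using assms
proof (induction xs rule: induct_list012)
  case 1
  then show ?case by (simp add: tuple_sign_changes_def tuple_sign_pattern_def)
next
  case (2 x)
  then show ?case by (simp add: tuple_sign_changes_def tuple_sign_pattern_def)
next
  case (3 x y zs)
  let ?D = "\<lambda>xs. {k. Suc k < length xs \<and> u (xs ! k) * u (xs ! Suc k) < 0}"
  have fin: "finite (?D (y # zs))"
    by (rule finite_subset[of _ "{..<length (y # zs)}"]) auto
  have D: "?D (x # y # zs) = (if u x * u y < 0 then {0} else {}) \<union> Suc ` ?D (y # zs)"
  proof (intro set_eqI)
    fix k
    show "k \<in> ?D (x # y # zs) \<longleftrightarrow>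
        k \<in> (if u x * u y < 0 then {0} else {}) \<union> Suc ` ?D (y # zs)"
      by (cases k) auto
  qed
  have "card (?D (x # y # zs)) = (if u x * u y < 0 then 1 else 0) + card (?D (y # zs))"
    unfolding D using fin by (subst card_Un_disjoint) (auto simp: card_image)
  moreover have "u x * u y < 0 \<longleftrightarrow> sgn (u x) \<noteq> sgn (u y)"
    using 3 by (auto simp: sgn_if mult_less_0_iff)
  \<comment> \<open>The truncated subtraction of 1 commutes with adding one run only if the pattern
    of the tail is nonempty.\<close>
  moreover have "length (remdups_adj (map (\<lambda>x. sgn (u x)) (y # zs))) \<ge> 1"
    by (metis One_nat_def list.simps(3) list.map_disc_iff remdups_adj_length_ge1)
  ultimately show ?case
    using 3 by (auto simp: tuple_sign_changes_def tuple_sign_pattern_def)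
qed

text \<open>At each level the only obstruction is the pattern +,-,+: an alternating pattern with
  four or more signs contains it, and one with three signs is either it or -,+,-.\<close>

lemma quasi_unimodal_iff:
  fixes f :: "'a::linorder \<Rightarrow> real"
  shows "quasi_unimodal f \<longleftrightarrow> (\<forall>i j k. i < j \<longrightarrow> j < k \<longrightarrow> min (f i) (f k) \<le> f j)"
    (is "_ \<longleftrightarrow> ?R")
proof
  assume qu: "quasi_unimodal f"
  show ?R
  proof (intro allI impI, rule ccontr)
    fix i j k
    assume ijk: "i < j" "j < k" and "\<not> min (f i) (f k) \<le> f j"
    then have "f j < min (f i) (f k)"
      by linarith
    \<comment> \<open>A level strictly inside the gap keeps all three shifted values nonzero, so
      \<open>[i, j, k]\<close> is an admissible tuple.\<close>
    then obtain c where "f j < c" "c < min (f i) (f k)"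
      using dense by blast
    then have c: "f j < c" "c < f i" "c < f k"
      by auto
    define v where "v = (\<lambda>x. f x - c)"
    have mem: "[i, j, k] \<in> nonzero_tuples v"
      using ijk c by (auto simp: nonzero_tuples_def v_def)
    have pat: "tuple_sign_pattern v [i, j, k] = [1, -1, 1]"
      using c by (simp add: tuple_sign_pattern_def v_def)
    have two: "tuple_sign_changes v [i, j, k] = 2"
      using mem pat by (simp add: tuple_sign_changes_eq_length_pattern nonzero_tuples_def)
    have "sign_changes v \<le> 2"
      using qu by (auto simp: quasi_unimodal_def v_def Let_def)
    \<comment> \<open>The pattern clause of the definition speaks only when the supremum equals 2,
      so the tuple has to supply the lower bound.\<close>
    moreover have "2 \<le> sign_changes v"
      unfolding sign_changes_def using mem two by (intro SUP_upper2) (auto simp: numeral_eq_enat)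
    ultimately have "sign_changes v = 2" by simp
    then have "tuple_sign_pattern v [i, j, k] = [-1, 1, -1]"
      using qu mem two by (auto simp: quasi_unimodal_def v_def Let_def)
    with pat show False by simp
  qed
next
  assume R: ?R
  have main: "tuple_sign_changes v xs \<le> 2 \<and>
      (tuple_sign_changes v xs = 2 \<longrightarrow> tuple_sign_pattern v xs = [-1, 1, -1])"
    if v: "v = (\<lambda>x. f x - c)" and xs: "xs \<in> nonzero_tuples v" for v c xs
  proof -
    from xs obtain ys where ys: "sorted_wrt (<) ys" "set ys \<subseteq> set xs"
        "map (\<lambda>x. sgn (v x)) ys = tuple_sign_pattern v xs"
      unfolding nonzero_tuples_def tuple_sign_pattern_def
      by (auto elim: remdups_adj_map_sorted_wrt)
    have nz: "v y \<noteq> 0" if "y \<in> set ys" for y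
      using xs ys that by (auto simp: nonzero_tuples_def)
    have adj: "distinct_adj (map (\<lambda>x. sgn (v x)) ys)"
      unfolding ys by (simp add: tuple_sign_pattern_def)
    have no: False if "i < j" "j < k" "sgn (v i) = 1" "sgn (v j) = -1" "sgn (v k) = 1" for i j k
    proof -
      have "min (f i) (f k) \<le> f j" using R that by blast
      moreover have "c < f i" "f j < c" "c < f k"
        using that by (auto simp: v sgn_1_pos sgn_1_neg)
      ultimately show False by linarith
    qed
    have sg: "sgn (v y) = 1 \<or> sgn (v y) = -1" if "y \<in> set ys" for y
      using nz[OF that] by (auto simp: sgn_if)
    have short: "length ys \<le> 3 \<and> (length ys = 3 \<longrightarrow> map (\<lambda>x. sgn (v x)) ys = [-1, 1, -1])"
    proof (cases ys rule: remdups_adj.cases)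
      case (3 a b zs)
      show ?thesis
      proof (cases zs)
        case Nil
        then show ?thesis using 3 by simp
      next
        case (Cons c cs)
        have abc: "a < b" "b < c" using ys 3 Cons by auto
        \<comment> \<open>Signs alternate along \<open>ys\<close>; a positive start would make
          \<open>a\<close>, \<open>b\<close>, \<open>c\<close> a forbidden triple.\<close>
        have A: "sgn (v a) = -1" "sgn (v b) = 1" "sgn (v c) = -1"
          using sg[of a] sg[of b] sg[of c] no[OF abc] adj 3 Cons by auto
        show ?thesis
        proof (cases cs)
          case Nil
          then show ?thesis using 3 Cons A by simp
        next
          case (Cons d ds)
          \<comment> \<open>A fourth point would be positive, and then \<open>b\<close>,
            \<open>c\<close>, \<open>d\<close> would be the forbidden triple.\<close>
          then have "c < d" "sgn (v d) = 1"
            using sg[of d] ys(1) 3 \<open>zs = c # cs\<close> adj A by auto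
          then show ?thesis using no[of b c d] abc A by simp
        qed
      qed
    qed auto
    have "tuple_sign_changes v xs = length ys - 1"
      using xs ys(3)[symmetric]
      by (subst tuple_sign_changes_eq_length_pattern) (auto simp: nonzero_tuples_def)
    with short ys(3) show ?thesis by auto
  qed
  show "quasi_unimodal f"
    unfolding quasi_unimodal_def Let_def
  proof (intro allI conjI impI ballI)
    fix c
    show "sign_changes (\<lambda>x. f x - c) \<le> 2"
      unfolding sign_changes_def using main[OF refl]
      by (intro SUP_least) (auto simp: numeral_eq_enat)
  qed (use main[OF refl] in blast)
qed

subsection \<open>Stochastic kernels\<close>

definition stochastic :: "('s \<Rightarrow> 's \<Rightarrow> real) \<Rightarrow> bool" where
  "stochastic K \<longleftrightarrow> (\<forall>i j. 0 \<le> K i j) \<and> (\<forall>i. (K i has_sum 1) UNIV)"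

lemma bounded_rangeE:
  assumes "bounded (range (f :: 'a \<Rightarrow> real))"
  obtains B where "\<And>x. \<bar>f x\<bar> \<le> B"
  using assms by (auto simp: bounded_iff)

text \<open>Domination by a multiple of the row \<open>K i\<close> gives absolute summability, so
  \<open>kernel_apply\<close> is a genuine sum and not the default value 0 of
  \<open>infsum\<close>.\<close>

lemma kernel_apply_has_sum:
  assumes "stochastic K" "bounded (range f)"
  shows "((\<lambda>j. K i j * f j) has_sum kernel_apply K f i) UNIV"
proof -
  obtain B where B: "\<And>x. \<bar>f x\<bar> \<le> B" using bounded_rangeE[OF assms(2)] by blast
  have "(\<lambda>j. norm (K i j * f j)) summable_on UNIV"
  proof (rule Infinite_Sum.abs_summable_on_comparison_test')
    show "(\<lambda>j. K i j * B) summable_on UNIV"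
      using assms(1) by (intro summable_on_cmult_left) (auto simp: stochastic_def summable_on_def)
    show "norm (K i j * f j) \<le> K i j * B" for j
      using assms(1) B[of j] by (simp add: stochastic_def abs_mult mult_left_mono)
  qed
  then show ?thesis
    unfolding kernel_apply_def by (intro has_sum_infsum) (rule abs_summable_summable)
qed

text \<open>A row of total mass 1 averages \<open>f\<close> over its support. Restricting the bound
  to the support is what later exploits that the chain only moves upwards.\<close>

lemma kernel_apply_le:
  assumes "stochastic K" "bounded (range f)" "\<And>j. K i j \<noteq> 0 \<Longrightarrow> f j \<le> c"
  shows "kernel_apply K f i \<le> c"
proof (rule has_sum_mono[OF kernel_apply_has_sum[OF assms(1,2)]])
  show "((\<lambda>j. K i j * c) has_sum c) UNIV"
    using assms(1) has_sum_cmult_left[of "K i" UNIV 1 c] by (simp add: stochastic_def)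
  show "K i j * f j \<le> K i j * c" for j
    using assms(1,3) by (cases "K i j = 0") (auto simp: stochastic_def intro!: mult_left_mono)
qed

lemma kernel_apply_uminus: "kernel_apply K (\<lambda>j. - f j) i = - kernel_apply K f i"
  by (simp add: kernel_apply_def infsum_uminus)

lemma kernel_apply_ge:
  assumes "stochastic K" "bounded (range f)" "\<And>j. K i j \<noteq> 0 \<Longrightarrow> c \<le> f j"
  shows "c \<le> kernel_apply K f i"
proof -
  have "bounded (range (\<lambda>j. - f j))"
    using assms(2) by (simp add: bounded_iff)
  from kernel_apply_le[OF assms(1) this, of i "- c"] assms(3) show ?thesis
    by (simp add: kernel_apply_uminus)
qed

lemma bounded_kernel_apply:
  assumes "stochastic K" "bounded (range f)"
  shows "bounded (range (kernel_apply K f))"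
proof -
  obtain B where B: "\<And>x. \<bar>f x\<bar> \<le> B" using bounded_rangeE[OF assms(2)] by blast
  have "\<bar>kernel_apply K f i\<bar> \<le> B" for i
    using kernel_apply_le[OF assms, of i B] kernel_apply_ge[OF assms, of i "- B"] B
    by (simp add: abs_le_iff minus_le_iff)
  then show ?thesis by (auto simp: bounded_iff)
qed

text \<open>Summing over \<open>j\<close> first leaves the summable row \<open>K i\<close>, and all
  terms are nonnegative. This justifies the interchanges of summation for composed kernels.\<close>

lemma summable_on_kernel_product:
  assumes "stochastic K" "stochastic L"
  shows "(\<lambda>(k, j). K i k * L k j) summable_on UNIV \<times> UNIV"
proof (rule summable_on_SigmaI)
  fix k
  show "((\<lambda>j. case (k, j) of (k, j) \<Rightarrow> K i k * L k j) has_sum K i k) UNIV"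
    using has_sum_cmult_right[of "L k" UNIV 1 "K i k"] assms(2) by (simp add: stochastic_def)
qed (use assms in \<open>auto simp: stochastic_def summable_on_def\<close>)

lemma stochastic_compose:
  assumes K: "stochastic K" and L: "stochastic L"
  shows "stochastic (\<lambda>i j. \<Sum>\<^sub>\<infinity>k\<in>UNIV. K i k * L k j)"
  unfolding stochastic_def
proof (intro conjI allI)
  fix i j
  show "0 \<le> (\<Sum>\<^sub>\<infinity>k\<in>UNIV. K i k * L k j)"
    using K L by (intro infsum_nonneg) (auto simp: stochastic_def)
  have S: "(\<lambda>(j, k). K i k * L k j) summable_on UNIV \<times> UNIV"
    using summable_on_kernel_product[OF K L, of i] by (subst summable_on_swap) simp
  have "(\<Sum>\<^sub>\<infinity>j\<in>UNIV. \<Sum>\<^sub>\<infinity>k\<in>UNIV. K i k * L k j) = (\<Sum>\<^sub>\<infinity>k\<in>UNIV. \<Sum>\<^sub>\<infinity>j\<in>UNIV. K i k * L k j)"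
    using S by (rule infsum_swap_banach)
  also have "\<dots> = 1"
  proof -
    have "infsum (K i) UNIV = 1" "infsum (L k) UNIV = 1" for k
      using K L by (auto simp: stochastic_def intro!: infsumI)
    then show ?thesis by (simp add: infsum_cmult_right')
  qed
  finally show "((\<lambda>j. \<Sum>\<^sub>\<infinity>k\<in>UNIV. K i k * L k j) has_sum 1) UNIV"
    using summable_on_Sigma_banach[OF S] by (simp add: has_sum_iff)
qed

text \<open>Fubini, with the nonnegative product family times a bound of \<open>f\<close> as
  majorant. It reduces powers of the kernel to repeated application.\<close>

lemma kernel_apply_compose:
  assumes K: "stochastic K" and L: "stochastic L" and f: "bounded (range f)"
  shows "kernel_apply (\<lambda>i j. \<Sum>\<^sub>\<infinity>k\<in>UNIV. K i k * L k j) f = kernel_apply K (kernel_apply L f)"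
proof
  fix i
  obtain B where B: "\<And>x. \<bar>f x\<bar> \<le> B" using bounded_rangeE[OF f] by blast
  have "(\<lambda>x. norm (case x of (k, j) \<Rightarrow> K i k * L k j * f j)) summable_on UNIV \<times> UNIV"
  proof (rule Infinite_Sum.abs_summable_on_comparison_test')
    show "(\<lambda>x. (case x of (k, j) \<Rightarrow> K i k * L k j) * B) summable_on UNIV \<times> UNIV"
      using summable_on_kernel_product[OF K L] by (rule summable_on_cmult_left)
    show "norm (case x of (k, j) \<Rightarrow> K i k * L k j * f j) \<le> (case x of (k, j) \<Rightarrow> K i k * L k j) * B"
      for x
      using K L B[of "snd x"]
      by (simp add: stochastic_def abs_mult mult_left_mono case_prod_unfold)
  qed
  then have S: "(\<lambda>(k, j). K i k * L k j * f j) summable_on UNIV \<times> UNIV"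
    by (rule abs_summable_summable)
  have "kernel_apply (\<lambda>i j. \<Sum>\<^sub>\<infinity>k\<in>UNIV. K i k * L k j) f i
      = (\<Sum>\<^sub>\<infinity>j\<in>UNIV. \<Sum>\<^sub>\<infinity>k\<in>UNIV. K i k * L k j * f j)"
    by (simp add: kernel_apply_def infsum_cmult_left')
  also have "\<dots> = (\<Sum>\<^sub>\<infinity>k\<in>UNIV. \<Sum>\<^sub>\<infinity>j\<in>UNIV. K i k * L k j * f j)"
    using S by (rule infsum_swap_banach[symmetric])
  also have "\<dots> = kernel_apply K (kernel_apply L f) i"
    by (simp add: kernel_apply_def mult.assoc infsum_cmult_right')
  finally show "kernel_apply (\<lambda>i j. \<Sum>\<^sub>\<infinity>k\<in>UNIV. K i k * L k j) f i
      = kernel_apply K (kernel_apply L f) i" .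
qed

lemma stochastic_kernel_power:
  assumes "stochastic K"
  shows "stochastic (kernel_power K n)"
proof (induction n)
  case 0
  have "((\<lambda>j. if i = j then 1 else 0::real) has_sum 1) UNIV" for i :: 'a
    by (rule has_sum_finite_neutralI[of "{i}"]) auto
  then show ?case by (simp add: stochastic_def)
next
  case (Suc n)
  then show ?case using stochastic_compose[OF assms] by simp
qed

lemma kernel_apply_power_Suc:
  assumes "stochastic K" "bounded (range f)"
  shows "kernel_apply (kernel_power K (Suc n)) f = kernel_apply K (kernel_apply (kernel_power K n) f)"
  using kernel_apply_compose[OF assms(1) stochastic_kernel_power[OF assms(1)] assms(2)] by simp

lemma kernel_apply_power_0: "kernel_apply (kernel_power K 0) f = f"
proof
  fix i
  have "((\<lambda>j. (if i = j then 1 else 0) * f j) has_sum f i) UNIV"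
    by (rule has_sum_finite_neutralI[of "{i}"]) auto
  then show "kernel_apply (kernel_power K 0) f i = f i"
    by (simp add: kernel_apply_def infsumI)
qed

subsection \<open>The success-epoch chain\<close>

context
  fixes p :: "nat \<Rightarrow> real"
  assumes p: "\<And>j. j \<ge> 1 \<Longrightarrow> 0 < p j \<and> p j \<le> 1"
begin

text \<open>The partial products decrease and stay nonnegative because every factor lies in [0,1].
  Hence the \<open>lim\<close> in the kernel is a true limit and not an arbitrary value.\<close>

lemma failure_prod_tendsto:
  "(\<lambda>n. \<Prod>k\<in>{a<..n}. 1 - p k) \<longlonglongrightarrow> success_kernel p (enat a) \<infinity>"
proof -
  let ?X = "\<lambda>n. \<Prod>k\<in>{a<..n}. 1 - p k"
  have nonneg: "0 \<le> ?X n" for n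
    using p by (intro prod_nonneg) auto
  have "decseq ?X"
  proof (rule decseq_SucI)
    fix n
    show "?X (Suc n) \<le> ?X n"
    proof (cases "a < Suc n")
      case True
      then have "{a<..Suc n} = insert (Suc n) {a<..n}" by auto
      then have "?X (Suc n) = (1 - p (Suc n)) * ?X n" by simp
      then show ?thesis
        using nonneg[of n] p[of "Suc n"] by (simp add: mult_left_le_one_le)
    qed simp
  qed
  then have "convergent ?X"
    using nonneg by (metis decseq_convergent convergentI)
  then show ?thesis
    by (simp add: success_kernel_def convergent_LIMSEQ_iff)
qed

lemma success_kernel_nonneg: "0 \<le> success_kernel p i j"
proof (cases i)
  case (enat a)
  show ?thesis
  proof (cases j)
    case (enat b)
    have "0 \<le> (\<Prod>k\<in>{a<..<b}. 1 - p k)"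
      using p by (intro prod_nonneg) auto
    then show ?thesis
      using p[of b] \<open>i = enat a\<close> enat by (auto simp: success_kernel_def)
  next
    case infinity
    have "0 \<le> (\<Prod>k\<in>{a<..n}. 1 - p k)" for n
      using p by (intro prod_nonneg) auto
    then show ?thesis
      using LIMSEQ_le_const[OF failure_prod_tendsto[of a]] enat infinity by blast
  qed
next
  case infinity
  then show ?thesis by (cases j) (auto simp: success_kernel_def)
qed

text \<open>Telescoping: since p = 1 - (1 - p), each entry is the difference of two consecutive
  failure products.\<close>

lemma success_kernel_partial_sum:
  "(\<Sum>b\<le>n. success_kernel p (enat a) (enat b)) = 1 - (\<Prod>k\<in>{a<..n}. 1 - p k)"
proof (induction n)
  case 0
  then show ?case by (simp add: success_kernel_def)
next
  case (Suc n)
  show ?case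
  proof (cases "a < Suc n")
    case True
    then have "{a<..Suc n} = insert (Suc n) {a<..n}" by auto
    moreover have "{a<..<Suc n} = {a<..n}" by auto
    ultimately show ?thesis
      using Suc True by (simp add: success_kernel_def algebra_simps)
  next
    case False
    then show ?thesis using Suc by (simp add: success_kernel_def)
  qed
qed

lemma range_enat_insert_infinity: "insert \<infinity> (range enat) = UNIV"
  by (metis UNIV_eq_I enat.exhaust insertCI rangeI infinity_enat_def)

lemma stochastic_success_kernel: "stochastic (success_kernel p)"
  unfolding stochastic_def
proof (intro conjI allI)
  fix i
  show "(success_kernel p i has_sum 1) UNIV"
  proof (cases i)
    case (enat a)
    let ?L = "success_kernel p (enat a) \<infinity>"
    have "(\<lambda>b. success_kernel p (enat a) (enat b)) sums (1 - ?L)"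
      unfolding sums_def_le success_kernel_partial_sum
      by (intro tendsto_intros failure_prod_tendsto)
    then have "((\<lambda>b. success_kernel p (enat a) (enat b)) has_sum (1 - ?L)) UNIV"
      by (rule sums_nonneg_imp_has_sum) (rule success_kernel_nonneg)
    then have "(success_kernel p (enat a) has_sum (1 - ?L)) (range enat)"
      by (subst has_sum_reindex) (auto simp: inj_on_def o_def)
    \<comment> \<open>The state \<infinity> carries exactly the mass that the finite states
      miss.\<close>
    then have "(success_kernel p (enat a) has_sum (?L + (1 - ?L))) (insert \<infinity> (range enat))"
      by (intro has_sum_insert) auto
    then show ?thesis
      using enat by (simp add: range_enat_insert_infinity)
  next
    case infinity
    have "success_kernel p \<infinity> = (\<lambda>j. if j = \<infinity> then 1 else 0)"
      by (auto simp: success_kernel_def split: enat.splits)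
    then show ?thesis
      unfolding infinity by (intro has_sum_finite_neutralI[of "{\<infinity>}"]) auto
  qed
qed (rule success_kernel_nonneg)

text \<open>Condition on trial \<open>Suc a\<close>: a success ends the jump there, and after a
  failure the search continues as if started from \<open>Suc a\<close>.\<close>

lemma success_kernel_step:
  "success_kernel p (enat a) j =
     p (Suc a) * (if j = enat (Suc a) then 1 else 0)
     + (1 - p (Suc a)) * success_kernel p (enat (Suc a)) j"
proof (cases j)
  case (enat b)
  show ?thesis
  proof (cases "Suc a < b")
    case True
    then have "{a<..<b} = insert (Suc a) {Suc a<..<b}" by auto
    then show ?thesis
      using True enat by (simp add: success_kernel_def)
  next
    case False
    moreover have "{a<..<Suc a} = {}" by auto
    ultimately show ?thesis
      using enat by (cases "b \<le> a") (auto simp: success_kernel_def not_less not_le le_Suc_eq)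
  qed
next
  case infinity
  have "(\<lambda>n. (1 - p (Suc a)) * (\<Prod>k\<in>{Suc a<..n}. 1 - p k)) \<longlonglongrightarrow>
      (1 - p (Suc a)) * success_kernel p (enat (Suc a)) \<infinity>"
    by (intro tendsto_intros failure_prod_tendsto)
  \<comment> \<open>The first factor can be split off only once the range reaches
    \<open>Suc a\<close>; for the limit, eventual equality is enough.\<close>
  moreover have "(1 - p (Suc a)) * (\<Prod>k\<in>{Suc a<..n}. 1 - p k) = (\<Prod>k\<in>{a<..n}. 1 - p k)"
    if "n \<ge> Suc a" for n
  proof -
    have "{a<..n} = insert (Suc a) {Suc a<..n}" using that by auto
    then show ?thesis by simp
  qed
  ultimately have "(\<lambda>n. \<Prod>k\<in>{a<..n}. 1 - p k) \<longlonglongrightarrow>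
      (1 - p (Suc a)) * success_kernel p (enat (Suc a)) \<infinity>"
    by (rule Lim_transform_eventually[OF _ eventually_sequentiallyI])
  then show ?thesis
    using infinity LIMSEQ_unique[OF failure_prod_tendsto] by simp
qed

lemma kernel_apply_success_step:
  assumes "bounded (range f)"
  shows "kernel_apply (success_kernel p) f (enat a) =
     p (Suc a) * f (enat (Suc a)) + (1 - p (Suc a)) * kernel_apply (success_kernel p) f (enat (Suc a))"
proof -
  let ?K = "success_kernel p" and ?b = "enat (Suc a)"
  have "((\<lambda>j. p (Suc a) * (if j = ?b then 1 else 0) * f j) has_sum p (Suc a) * f ?b) UNIV"
    by (rule has_sum_finite_neutralI[of "{?b}"]) auto
  moreover have "((\<lambda>j. (1 - p (Suc a)) * (?K ?b j * f j)) has_sum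
      (1 - p (Suc a)) * kernel_apply ?K f ?b) UNIV"
    by (intro has_sum_cmult_right kernel_apply_has_sum stochastic_success_kernel assms)
  ultimately have "((\<lambda>j. ?K (enat a) j * f j) has_sum
      (p (Suc a) * f ?b + (1 - p (Suc a)) * kernel_apply ?K f ?b)) UNIV"
    unfolding success_kernel_step[of a]
    by (auto dest: has_sum_add simp: distrib_right mult.assoc)
  then show ?thesis
    by (simp add: kernel_apply_def infsumI)
qed

lemma kernel_apply_success_infinity: "kernel_apply (success_kernel p) f \<infinity> = f \<infinity>"
proof -
  have "((\<lambda>j. success_kernel p \<infinity> j * f j) has_sum f \<infinity>) UNIV"
    by (rule has_sum_finite_neutralI[of "{\<infinity>}"]) (auto simp: success_kernel_def split: enat.splits)
  then show ?thesis
    by (simp add: kernel_apply_def infsumI)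
qed

lemma success_kernel_support:
  assumes "success_kernel p (enat a) j \<noteq> 0"
  shows "enat a < j"
  using assms by (cases j) (auto simp: success_kernel_def split: if_splits)

text \<open>Downward induction from \<open>b\<close>: by the one-step recursion, each value is a
  convex combination of two numbers already known to be at most \<open>c\<close>.\<close>

lemma kernel_apply_success_le_backwards:
  assumes f: "bounded (range f)" and "a \<le> b"
    and "\<And>m. a < m \<Longrightarrow> m \<le> b \<Longrightarrow> f (enat m) \<le> c"
    and "kernel_apply (success_kernel p) f (enat b) \<le> c"
  shows "kernel_apply (success_kernel p) f (enat a) \<le> c"
  using assms(2-)
proof (induction rule: inc_induct)
  case (step m)
  have "kernel_apply (success_kernel p) f (enat (Suc m)) \<le> c"
    using step by auto
  moreover have "f (enat (Suc m)) \<le> c"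
    using step by auto
  ultimately show ?case
    using p[of "Suc m"] unfolding kernel_apply_success_step[OF f, of m]
    by (intro convex_bound_le) auto
qed

lemma kernel_apply_success_ge_backwards:
  assumes f: "bounded (range f)" and "a \<le> b"
    and "\<And>m. a < m \<Longrightarrow> m \<le> b \<Longrightarrow> c \<le> f (enat m)"
    and "c \<le> kernel_apply (success_kernel p) f (enat b)"
  shows "c \<le> kernel_apply (success_kernel p) f (enat a)"
proof -
  have "bounded (range (\<lambda>j. - f j))"
    using f by (simp add: bounded_iff)
  from kernel_apply_success_le_backwards[OF this assms(2), of "- c"] assms(3,4) show ?thesis
    by (simp add: kernel_apply_uminus)
qed

lemma quasi_unimodal_kernel_apply_success:
  assumes f: "bounded (range f)" and qu: "quasi_unimodal f"
  shows "quasi_unimodal (kernel_apply (success_kernel p) f)"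
  unfolding quasi_unimodal_iff
proof (intro allI impI, rule ccontr)
  let ?g = "kernel_apply (success_kernel p) f"
  fix i j k :: enat
  assume ij: "i < j" and jk: "j < k" and "\<not> min (?g i) (?g k) \<le> ?g j"
  then have "?g j < min (?g i) (?g k)"
    by linarith
  then obtain c where "?g j < c" "c < min (?g i) (?g k)"
    using dense by blast
  then have c: "?g j < c" "c < ?g i" "c < ?g k"
    by auto
  \<comment> \<open>Only \<open>k\<close> can be \<infinity>, since \<open>i\<close> and
    \<open>j\<close> lie strictly below another state.\<close>
  from jk obtain b where b: "j = enat b" by (cases j) auto
  with ij obtain a where a: "i = enat a" and "a < b" by (cases i) auto
  \<comment> \<open>Otherwise the bound \<open>?g j < c\<close> would propagate back to
    \<open>i\<close>.\<close>
  have "\<exists>m. a < m \<and> m \<le> b \<and> c < f (enat m)"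
  proof (rule ccontr)
    assume "\<not> ?thesis"
    then have "?g (enat a) \<le> c"
      using c \<open>a < b\<close> b by (intro kernel_apply_success_le_backwards[OF f, of a b]) force+
    then show False using c a by simp
  qed
  then obtain m1 where m1: "m1 \<le> b" "c < f (enat m1)" by blast
  have "\<exists>m. j < m \<and> m \<le> k \<and> f m < c"
  proof (rule ccontr)
    assume *: "\<not> ?thesis"
    have "c \<le> ?g (enat b)"
    proof (cases k)
      case (enat d)
      show ?thesis
      proof (rule kernel_apply_success_ge_backwards[OF f])
        show "b \<le> d" "c \<le> ?g (enat d)"
          using c jk b enat by auto
        show "c \<le> f (enat m)" if "b < m" "m \<le> d" for m
          using * that b enat by (metis enat_ord_simps(1,2) not_less)
      qed
    next
      case infinity
      \<comment> \<open>Backward induction cannot start at \<infinity>. Instead, the row of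
        \<open>b\<close> charges only states above \<open>b\<close>, where \<open>f\<close> is at
        least \<open>c\<close> by assumption.\<close>
      with * b show ?thesis
        by (intro kernel_apply_ge stochastic_success_kernel f)
          (use success_kernel_support in \<open>force\<close>)
    qed
    then show False using c b by simp
  qed
  then obtain m2 where m2: "j < m2" "m2 \<le> k" "f m2 < c" by blast
  have "\<exists>m3>m2. c < f m3"
  proof (cases k)
    case (enat d)
    show ?thesis
    proof (rule ccontr)
      assume *: "\<not> ?thesis"
      have "?g k \<le> c"
        unfolding enat
      proof (intro kernel_apply_le stochastic_success_kernel f)
        fix m
        assume "success_kernel p (enat d) m \<noteq> 0"
        then have "k < m"
          using success_kernel_support enat by simp
        \<comment> \<open>The row of \<open>k\<close> charges only states above \<open>k\<close>,
          hence above \<open>m2\<close>; an average exceeding \<open>c\<close> needs a value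
          exceeding \<open>c\<close> among them.\<close>
        with m2(2) have "m2 < m" by (rule le_less_trans)
        then show "f m \<le> c" using * by auto
      qed
      then show False using c by simp
    qed
  next
    case infinity
    \<comment> \<open>The state \<infinity> is absorbing, so \<open>?g\<close> and \<open>f\<close>
      agree there and \<infinity> itself serves as the third point.\<close>
    then have "c < f \<infinity>" using c by (simp add: kernel_apply_success_infinity)
    moreover have "m2 \<noteq> \<infinity>"
      using \<open>c < f \<infinity>\<close> m2(3) by (cases "m2 = \<infinity>") auto
    ultimately show ?thesis
      by (intro exI[of _ \<infinity>]) simp
  qed
  then obtain m3 where m3: "m2 < m3" "c < f m3" by blast
  have "enat m1 \<le> j" using m1(1) b by simp
  then have "enat m1 < m2" using m2(1) by (rule le_less_trans)
  then have "min (f (enat m1)) (f m3) \<le> f m2"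
    using qu[unfolded quasi_unimodal_iff] m3(1) by simp
  then show False using m1 m2 m3 by linarith
qed

end

theorem lemma3:
  fixes p :: "nat \<Rightarrow> real" and n :: nat and f :: "enat \<Rightarrow> real"
  assumes "\<And>j. j \<ge> 1 \<Longrightarrow> 0 < p j \<and> p j \<le> 1"
    and "n \<ge> 1"
    and "bounded (range f)"
    and "quasi_unimodal f"
  shows "quasi_unimodal (kernel_apply (kernel_power (success_kernel p) n) f)"
proof (induction n)
  case 0
  show ?case using assms(4) by (simp only: kernel_apply_power_0)
next
  case (Suc n)
  have st: "stochastic (success_kernel p)"
    using assms(1) by (rule stochastic_success_kernel)
  show ?case
    unfolding kernel_apply_power_Suc[OF st assms(3)]
  proof (rule quasi_unimodal_kernel_apply_success)
    \<comment> \<open>The one-step result needs a bounded argument; averaging against the stochastic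
      power preserves bounds.\<close>
    show "bounded (range (kernel_apply (kernel_power (success_kernel p) n) f))"
      by (intro bounded_kernel_apply stochastic_kernel_power st assms(3))
  qed (fact assms(1) Suc)+
qed

end
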